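(* For every integer $n\ge1$, there are bijections between the three sets $(\mathcal{NG}\text{-}1)_n$, $(\mathcal{NG}\text{-}2)_n$ and $\mathcal{S}_{n-1}$.
   Context: All graphs are finite, simple and unlabeled (considered up to isomorphism). For a class $\mathcal{C}$, $\mathcal{C}_k$ denotes the set of graphs in $\mathcal{C}$ with $k$ vertices. $\chi$ is chromatic number, $\overline{G}$ the complement. $G$ is an NG-graph if $\chi(G)+\chi(\overline{G})=|V(G)|+1$; its ABC-partition is $A=\{v:\deg(v)=\chi(G)-1\}$, $B=\{v:\deg(v)>\chi(G)-1\}$, $C=\{v:\deg(v)<\chi(G)-1\}$. $\mathcal{NG}\text{-}1$ (resp. $\mathcal{NG}\text{-}2$) is the set of NG-graphs with $G[A]$ a clique (resp. a stable set). $\mathcal{S}$ is the set of split graphs (graphs whose vertex set partitions into a clique and a stable set), including the graph with $0$ vertices. *)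

theory Defs
  imports Main
begin

record 'a graph =
  verts :: "'a set"
  edges :: "'a set set"

definition fin_simple_graph :: "'a graph \<Rightarrow> bool" where
  "fin_simple_graph G \<longleftrightarrow>
     finite (verts G) \<and> (\<forall>e\<in>edges G. e \<subseteq> verts G \<and> card e = 2)"

definition graph_complement :: "'a graph \<Rightarrow> 'a graph" where
  "graph_complement G =
     \<lparr>verts = verts G, edges = {e. e \<subseteq> verts G \<and> card e = 2 \<and> e \<notin> edges G}\<rparr>"

definition degree :: "'a graph \<Rightarrow> 'a \<Rightarrow> nat" where
  "degree G v = card {e \<in> edges G. v \<in> e}"

definition proper_coloring :: "'a graph \<Rightarrow> nat \<Rightarrow> ('a \<Rightarrow> nat) \<Rightarrow> bool" where
  "proper_coloring G k c \<longleftrightarrow>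
     (\<forall>v\<in>verts G. c v < k) \<and> (\<forall>u v. {u, v} \<in> edges G \<longrightarrow> c u \<noteq> c v)"

definition chromatic_number :: "'a graph \<Rightarrow> nat" where
  "chromatic_number G = (LEAST k. \<exists>c. proper_coloring G k c)"

definition clique :: "'a graph \<Rightarrow> 'a set \<Rightarrow> bool" where
  "clique G K \<longleftrightarrow> K \<subseteq> verts G \<and> (\<forall>u\<in>K. \<forall>v\<in>K. u \<noteq> v \<longrightarrow> {u, v} \<in> edges G)"

definition stable_set :: "'a graph \<Rightarrow> 'a set \<Rightarrow> bool" where
  "stable_set G S \<longleftrightarrow> S \<subseteq> verts G \<and> (\<forall>u\<in>S. \<forall>v\<in>S. {u, v} \<notin> edges G)"

definition split_graph :: "'a graph \<Rightarrow> bool" where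
  "split_graph G \<longleftrightarrow> fin_simple_graph G \<and>
     (\<exists>K S. K \<union> S = verts G \<and> K \<inter> S = {} \<and> clique G K \<and> stable_set G S)"

definition NG_graph :: "'a graph \<Rightarrow> bool" where
  "NG_graph G \<longleftrightarrow> fin_simple_graph G \<and>
     chromatic_number G + chromatic_number (graph_complement G) = card (verts G) + 1"

text \<open>The \<open>A\<close>-part of the \<open>ABC\<close>-partition. Truncated subtraction is harmless here:
  the chromatic number is \<open>0\<close> only if there are no vertices.\<close>

definition A_part :: "'a graph \<Rightarrow> 'a set" where
  "A_part G = {v \<in> verts G. degree G v = chromatic_number G - 1}"

definition NG1_graph :: "'a graph \<Rightarrow> bool" where
  "NG1_graph G \<longleftrightarrow> NG_graph G \<and> clique G (A_part G)"

definition NG2_graph :: "'a graph \<Rightarrow> bool" where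
  "NG2_graph G \<longleftrightarrow> NG_graph G \<and> stable_set G (A_part G)"

definition graph_iso :: "'a graph \<Rightarrow> 'b graph \<Rightarrow> bool" where
  "graph_iso G H \<longleftrightarrow> (\<exists>f. bij_betw f (verts G) (verts H) \<and>
     (\<forall>u\<in>verts G. \<forall>v\<in>verts G. {u, v} \<in> edges G \<longleftrightarrow> {f u, f v} \<in> edges H))"

text \<open>An unlabeled graph is an isomorphism class of finite simple graphs. Every finite simple
  graph is isomorphic to one whose vertices are natural numbers, so it suffices to take
  isomorphism classes of the latter.\<close>

definition iso_rel :: "(nat graph \<times> nat graph) set" where
  "iso_rel = {(G, H). fin_simple_graph G \<and> fin_simple_graph H \<and> graph_iso G H}"

definition unlabeled :: "(nat graph \<Rightarrow> bool) \<Rightarrow> nat \<Rightarrow> nat graph set set" where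
  "unlabeled C k = {G. fin_simple_graph G \<and> C G \<and> card (verts G) = k} // iso_rel"

end

theory Submission
  imports Defs "HOL-Combinatorics.Transposition"
begin

text \<open>Complementation keeps the \<open>A\<close>-part and exchanges the two classes of NG-graphs. If the
  \<open>A\<close>-part is a clique, a colouring of \<open>A \<union> B\<close> with \<open>\<chi>(G) - 1\<close> colours would extend greedily to \<open>C\<close>,
  so \<open>|A \<union> B| \<ge> \<chi>(G)\<close>; dually, \<open>|C| + 1\<close> is at least the chromatic number of the complement. The
  NG-equation forces equality in both, which makes \<open>A \<union> B\<close> a clique, \<open>C\<close> a stable set and \<open>A\<close> a nonempty
  set of twins without neighbours in \<open>C\<close>. Deleting one of these twins leaves a split graph with a split
  partition whose clique is maximum; conversely, such a partition is unique up to an automorphism,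
  so adding a vertex adjacent to exactly its clique undoes the deletion.\<close>

section \<open>Finite simple graphs and isomorphisms\<close>

lemma fin_simple_graphD:
  assumes "fin_simple_graph G" "{u, v} \<in> edges G"
  shows "u \<in> verts G" "v \<in> verts G" "u \<noteq> v"
  using assms unfolding fin_simple_graph_def by fastforce+

lemma no_loop: "fin_simple_graph G \<Longrightarrow> {v} \<notin> edges G"
  using fin_simple_graphD(3)[of G v v] by auto

lemma degree_conv_card_neighbours:
  assumes "fin_simple_graph G"
  shows "degree G v = card {u. {u, v} \<in> edges G}"
proof -
  have "{e \<in> edges G. v \<in> e} = (\<lambda>u. {u, v}) ` {u. {u, v} \<in> edges G}"
  proof (intro equalityI subsetI)
    fix e assume e: "e \<in> {e \<in> edges G. v \<in> e}"
    then have "card e = 2" using assms by (auto simp: fin_simple_graph_def)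
    then obtain x y where "e = {x, y}" by (auto simp: card_2_iff)
    with e show "e \<in> (\<lambda>u. {u, v}) ` {u. {u, v} \<in> edges G}"
      by (auto simp: insert_commute)
  qed auto
  moreover have "inj_on (\<lambda>u. {u, v}) {u. {u, v} \<in> edges G}"
    by (auto simp: inj_on_def doubleton_eq_iff)
  ultimately show ?thesis unfolding degree_def by (simp add: card_image)
qed

lemma finite_neighbours: "fin_simple_graph G \<Longrightarrow> finite {u. {u, v} \<in> edges G}"
  by (rule finite_subset[of _ "verts G"])
    (auto dest: fin_simple_graphD simp: fin_simple_graph_def)

text \<open>Names the map hidden in \<open>graph_iso\<close>, since later arguments must compose
  such maps and follow the images of single vertices and cliques.\<close>

definition graph_isomorphism :: "('a \<Rightarrow> 'b) \<Rightarrow> 'a graph \<Rightarrow> 'b graph \<Rightarrow> bool" where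
  "graph_isomorphism f G H \<longleftrightarrow> bij_betw f (verts G) (verts H) \<and>
     (\<forall>u\<in>verts G. \<forall>v\<in>verts G. {u, v} \<in> edges G \<longleftrightarrow> {f u, f v} \<in> edges H)"

lemma graph_iso_conv: "graph_iso G H \<longleftrightarrow> (\<exists>f. graph_isomorphism f G H)"
  by (simp add: graph_iso_def graph_isomorphism_def)

lemma graph_isomorphism_id: "graph_isomorphism id G G"
  by (simp add: graph_isomorphism_def)

lemma graph_isomorphism_comp:
  assumes "graph_isomorphism f G H" "graph_isomorphism g H I"
  shows "graph_isomorphism (g \<circ> f) G I"
  using assms bij_betw_trans[of f "verts G" "verts H" g "verts I"]
  by (auto simp: graph_isomorphism_def dest: bij_betwE)

lemma graph_isomorphism_inv:
  assumes "graph_isomorphism f G H"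
  shows "graph_isomorphism (inv_into (verts G) f) H G"
proof -
  have f: "bij_betw f (verts G) (verts H)"
    using assms by (simp add: graph_isomorphism_def)
  then have g: "bij_betw (inv_into (verts G) f) (verts H) (verts G)"
    by (rule bij_betw_inv_into)
  show ?thesis
    using assms g bij_betwE[OF g] bij_betw_inv_into_right[OF f]
    by (simp add: graph_isomorphism_def)
qed

lemma equiv_iso_rel: "equiv {G. fin_simple_graph G} iso_rel"
proof (rule equivI)
  show "refl_on {G. fin_simple_graph G} iso_rel"
    using graph_isomorphism_id by (auto simp: refl_on_def iso_rel_def graph_iso_conv)
  show "sym iso_rel"
    using graph_isomorphism_inv by (fastforce simp: sym_def iso_rel_def graph_iso_conv)
  show "trans iso_rel"
    using graph_isomorphism_comp by (fastforce simp: trans_def iso_rel_def graph_iso_conv)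
  show "iso_rel \<subseteq> {G. fin_simple_graph G} \<times> {G. fin_simple_graph G}"
    by (auto simp: iso_rel_def)
qed

text \<open>A relation \<open>R\<close> is used because the intended correspondence involves
  choices: which vertex to delete, or where to attach a new one. Being total on both sides and
  matching \<open>r\<close> with \<open>s\<close> is enough for \<open>R\<close> to induce a
  bijection of classes.\<close>

lemma bij_betw_quotients:
  assumes r: "equiv A r" "P \<subseteq> A" and s: "equiv B s" "Q \<subseteq> B"
    and left: "\<And>x. x \<in> P \<Longrightarrow> \<exists>y\<in>Q. R x y"
    and right: "\<And>y. y \<in> Q \<Longrightarrow> \<exists>x\<in>P. R x y"
    and compat: "\<And>x x' y y'. \<lbrakk>x \<in> P; x' \<in> P; y \<in> Q; y' \<in> Q; R x y; R x' y'\<rbrakk>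
      \<Longrightarrow> (x, x') \<in> r \<longleftrightarrow> (y, y') \<in> s"
  shows "\<exists>f. bij_betw f (P // r) (Q // s)"
proof -
  \<comment> \<open>No representative is chosen: all partners of all members are collected and
    closed under \<open>s\<close>. By \<open>compat\<close> they form a single class.\<close>
  define f where "f X = s `` {y \<in> Q. \<exists>x\<in>X \<inter> P. R x y}" for X
  have class_refl: "x \<in> r `` {x}" if "x \<in> P" for x
    using equiv_class_self[OF r(1)] r(2) that by blast
  have f: "f (r `` {x}) = s `` {y}" if "x \<in> P" "y \<in> Q" "R x y" for x y
  proof -
    have "(y, y') \<in> s" if "y' \<in> Q" "x' \<in> r `` {x} \<inter> P" "R x' y'" for x' y'
      using compat[of x x' y y'] that \<open>x \<in> P\<close> \<open>y \<in> Q\<close> \<open>R x y\<close> by auto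
    then show ?thesis
      using that class_refl[OF \<open>x \<in> P\<close>] s(1) unfolding f_def equiv_def
      by (blast dest: transD)
  qed
  have "bij_betw f (P // r) (Q // s)"
  proof (rule bij_betwI')
    fix X X' assume "X \<in> P // r" "X' \<in> P // r"
    then obtain x x' where x: "x \<in> P" "X = r `` {x}" "x' \<in> P" "X' = r `` {x'}"
      by (auto elim!: quotientE)
    obtain y y' where y: "y \<in> Q" "R x y" "y' \<in> Q" "R x' y'"
      using left x by meson
    have "f X = s `` {y}" "f X' = s `` {y'}" "y \<in> B" "y' \<in> B" "x \<in> A" "x' \<in> A"
      using x y f r(2) s(2) by auto
    note this [simp]
    have "f X = f X' \<longleftrightarrow> (y, y') \<in> s"
      using eq_equiv_class_iff[OF s(1), of y y'] by simp
    also have "\<dots> \<longleftrightarrow> X = X'"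
      using compat[of x x' y y'] x y eq_equiv_class_iff[OF r(1), of x x'] by simp
    finally show "f X = f X' \<longleftrightarrow> X = X'" .
  next
    fix X assume "X \<in> P // r"
    then show "f X \<in> Q // s" using left f by (fastforce elim!: quotientE intro: quotientI)
  next
    fix Y assume "Y \<in> Q // s"
    then show "\<exists>X\<in>P // r. Y = f X" using right f by (fastforce elim!: quotientE intro: quotientI)
  qed
  then show ?thesis by blast
qed

section \<open>Complements\<close>

lemma fin_simple_graph_complement: "fin_simple_graph G \<Longrightarrow> fin_simple_graph (graph_complement G)"
  by (auto simp: fin_simple_graph_def graph_complement_def)

lemma graph_complement_involutive:
  "fin_simple_graph G \<Longrightarrow> graph_complement (graph_complement G) = G"
  by (cases G) (auto simp: fin_simple_graph_def graph_complement_def)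

lemma verts_graph_complement [simp]: "verts (graph_complement G) = verts G"
  by (simp add: graph_complement_def)

lemma edge_graph_complement:
  "{u, v} \<in> edges (graph_complement G) \<longleftrightarrow>
     u \<in> verts G \<and> v \<in> verts G \<and> u \<noteq> v \<and> {u, v} \<notin> edges G"
  by (auto simp: graph_complement_def card_insert_if)

lemma clique_graph_complement:
  "fin_simple_graph G \<Longrightarrow> clique (graph_complement G) S \<longleftrightarrow> stable_set G S"
  by (auto simp: clique_def stable_set_def edge_graph_complement dest: fin_simple_graphD(3))

lemma stable_set_graph_complement:
  "fin_simple_graph G \<Longrightarrow> stable_set (graph_complement G) K \<longleftrightarrow> clique G K"
  unfolding clique_def stable_set_def edge_graph_complement verts_graph_complement
  using fin_simple_graphD(3)[of G] by blast

lemma degree_graph_complement: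
  assumes "fin_simple_graph G" "v \<in> verts G"
  shows "degree G v + degree (graph_complement G) v + 1 = card (verts G)"
proof -
  let ?N = "{u. {u, v} \<in> edges G}" and ?M = "{u. {u, v} \<in> edges (graph_complement G)}"
  have "verts G - {v} = ?N \<union> ?M" "?N \<inter> ?M = {}"
    using assms by (auto simp: edge_graph_complement dest: fin_simple_graphD)
  then have "card (verts G - {v}) = card ?N + card ?M"
    using assms by (simp add: card_Un_disjoint finite_neighbours fin_simple_graph_complement)
  moreover have "card (verts G) = Suc (card (verts G - {v}))"
    using assms by (metis card_Suc_Diff1 fin_simple_graph_def)
  ultimately show ?thesis
    unfolding degree_conv_card_neighbours[OF assms(1)]
      degree_conv_card_neighbours[OF fin_simple_graph_complement[OF assms(1)]] by linarith
qed

lemma graph_isomorphism_complement: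
  assumes "graph_isomorphism f G H"
  shows "graph_isomorphism f (graph_complement G) (graph_complement H)"
proof -
  have f: "bij_betw f (verts G) (verts H)" using assms by (simp add: graph_isomorphism_def)
  show ?thesis
    using assms bij_betwE[OF f] inj_on_eq_iff[OF bij_betw_imp_inj_on[OF f]]
    by (simp add: graph_isomorphism_def edge_graph_complement)
qed

lemma iso_rel_complement:
  assumes "(G, H) \<in> iso_rel"
  shows "(graph_complement G, graph_complement H) \<in> iso_rel"
  using assms
  by (auto simp: iso_rel_def graph_iso_conv fin_simple_graph_complement
      intro: graph_isomorphism_complement)

section \<open>Chromatic number\<close>

lemma chromatic_number_le: "proper_coloring G k c \<Longrightarrow> chromatic_number G \<le> k"
  unfolding chromatic_number_def by (rule Least_le) blast

text \<open>The least \<open>k\<close> exists because an injective numbering of the finite vertex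
  set is already a proper colouring.\<close>

lemma chromatic_number_attained:
  assumes "fin_simple_graph G"
  shows "\<exists>c. proper_coloring G (chromatic_number G) c"
proof -
  obtain c where "bij_betw c (verts G) {0..<card (verts G)}"
    using ex_bij_betw_finite_nat[of "verts G"] assms by (auto simp: fin_simple_graph_def)
  then have "proper_coloring G (card (verts G)) c"
    using assms unfolding proper_coloring_def
    by (auto dest: bij_betwE bij_betw_imp_inj_on inj_onD fin_simple_graphD)
  then show ?thesis
    unfolding chromatic_number_def by (intro LeastI) blast
qed

lemma card_clique_le_chromatic_number:
  assumes "fin_simple_graph G" "clique G K"
  shows "card K \<le> chromatic_number G"
proof -
  obtain c where c: "proper_coloring G (chromatic_number G) c"
    using chromatic_number_attained assms by blast
  then have "inj_on c K"
    using assms(2) unfolding inj_on_def clique_def proper_coloring_def by metis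
  moreover have "c ` K \<subseteq> {..<chromatic_number G}"
    using c assms(2) by (auto simp: clique_def proper_coloring_def)
  ultimately show ?thesis
    using card_inj_on_le[of c K "{..<chromatic_number G}"] by simp
qed

lemma chromatic_number_pos:
  assumes "fin_simple_graph G" "v \<in> verts G"
  shows "0 < chromatic_number G"
  using card_clique_le_chromatic_number[of G "{v}"] assms by (simp add: clique_def)

text \<open>A vertex of degree below \<open>k\<close> sees fewer than \<open>k\<close> colours, so
  one of the \<open>k\<close> colours is always free for it.\<close>

lemma greedy_coloring_extension:
  assumes G: "fin_simple_graph G"
    and W: "finite W" "\<forall>v\<in>W. degree G v < k"
    and c: "\<forall>u\<in>U. c u < k" "\<forall>u\<in>U. \<forall>v\<in>U. {u, v} \<in> edges G \<longrightarrow> c u \<noteq> c v"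
  shows "\<exists>d. (\<forall>u\<in>U \<union> W. d u < k) \<and>
    (\<forall>u\<in>U \<union> W. \<forall>v\<in>U \<union> W. {u, v} \<in> edges G \<longrightarrow> d u \<noteq> d v)"
  using W
proof (induction W)
  case empty
  then show ?case using c by auto
next
  case (insert w W)
  then obtain d where d: "\<forall>u\<in>U \<union> W. d u < k"
    "\<forall>u\<in>U \<union> W. \<forall>v\<in>U \<union> W. {u, v} \<in> edges G \<longrightarrow> d u \<noteq> d v" by auto
  let ?N = "{u. {u, w} \<in> edges G}"
  show ?case
  proof (cases "w \<in> U \<union> W")
    case True
    then have "U \<union> insert w W = U \<union> W" by auto
    then show ?thesis using d by auto
  next
    case False
    have "card (d ` ?N) < k"
      using insert.prems card_image_le[OF finite_neighbours[OF G], of d w]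
      by (simp add: degree_conv_card_neighbours[OF G])
    then have "\<not> {..<k} \<subseteq> d ` ?N"
      using card_mono[OF finite_imageI[OF finite_neighbours[OF G]], of "{..<k}" d w] by auto
    then obtain j where j: "j < k" "j \<notin> d ` ?N" by auto
    then have "j \<noteq> d u" if "{u, w} \<in> edges G" for u using that by blast
    then have "\<forall>u\<in>U \<union> insert w W. (d(w := j)) u < k"
      "\<forall>u\<in>U \<union> insert w W. \<forall>v\<in>U \<union> insert w W.
        {u, v} \<in> edges G \<longrightarrow> (d(w := j)) u \<noteq> (d(w := j)) v"
      using d j False no_loop[OF G] by (auto simp: insert_commute)
    then show ?thesis by blast
  qed
qed

text \<open>Form of the greedy bound used for all upper bounds below. Colours on \<open>U\<close>
  may come from any type, for instance the vertices themselves, because \<open>h\<close> renumbers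
  them and only their number counts.\<close>

lemma chromatic_number_le_extension:
  assumes G: "fin_simple_graph G" and U: "U \<subseteq> verts G" "card (c ` U) \<le> k"
    and c: "\<And>u v. \<lbrakk>u \<in> U; v \<in> U; {u, v} \<in> edges G\<rbrakk> \<Longrightarrow> c u \<noteq> c v"
    and low: "\<And>v. v \<in> verts G \<Longrightarrow> v \<notin> U \<Longrightarrow> degree G v < k"
  shows "chromatic_number G \<le> k"
proof -
  have fin: "finite (verts G)" using G by (simp add: fin_simple_graph_def)
  then have "finite (c ` U)" using U finite_subset by blast
  then obtain h where h: "bij_betw h (c ` U) {0..<card (c ` U)}"
    using ex_bij_betw_finite_nat by blast
  have "\<forall>u\<in>U. (h \<circ> c) u < k" using bij_betwE[OF h] U(2) by fastforce
  moreover have "\<forall>u\<in>U. \<forall>v\<in>U. {u, v} \<in> edges G \<longrightarrow> (h \<circ> c) u \<noteq> (h \<circ> c) v"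
    using c inj_onD[OF bij_betw_imp_inj_on[OF h]] by fastforce
  ultimately obtain d where "\<forall>u\<in>U \<union> (verts G - U). d u < k"
    "\<forall>u\<in>U \<union> (verts G - U). \<forall>v\<in>U \<union> (verts G - U). {u, v} \<in> edges G \<longrightarrow> d u \<noteq> d v"
    using greedy_coloring_extension[OF G, of "verts G - U" k U "h \<circ> c"] fin low by auto
  then have "proper_coloring G k d"
    using fin_simple_graphD[OF G] by (auto simp: proper_coloring_def)
  then show ?thesis by (rule chromatic_number_le)
qed

section \<open>NG-graphs under complementation\<close>

lemma NG_graph_nonempty: "NG_graph G \<Longrightarrow> verts G \<noteq> {}"
proof
  assume "NG_graph G" "verts G = {}"
  \<comment> \<open>Without vertices, zero colours suffice on both sides, so the NG-equation would
    read 0 = 1.\<close>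
  then have colorings: "proper_coloring G 0 (\<lambda>_. 0)" "proper_coloring (graph_complement G) 0 (\<lambda>_. 0)"
    by (auto simp: NG_graph_def proper_coloring_def edge_graph_complement dest: fin_simple_graphD)
  then show False
    using \<open>NG_graph G\<close> \<open>verts G = {}\<close> colorings[THEN chromatic_number_le]
    by (simp add: NG_graph_def)
qed

lemma NG_graph_complement:
  assumes "NG_graph G"
  shows "NG_graph (graph_complement G)"
  using assms
  by (simp add: NG_graph_def fin_simple_graph_complement graph_complement_involutive)

text \<open>The degrees of \<open>v\<close> in the two graphs sum to
  \<open>card (verts G) - 1\<close>, and by the NG-equation so do the two chromatic numbers minus
  one each. Hence one equality forces the other; positivity makes the truncated subtractions
  exact.\<close>

lemma A_part_graph_complement:
  assumes "NG_graph G"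
  shows "A_part (graph_complement G) = A_part G"
proof -
  have G: "fin_simple_graph G" using assms by (simp add: NG_graph_def)
  have "degree (graph_complement G) v = chromatic_number (graph_complement G) - 1 \<longleftrightarrow>
      degree G v = chromatic_number G - 1" if v: "v \<in> verts G" for v
    using assms v degree_graph_complement[OF G v] chromatic_number_pos[OF G v]
      chromatic_number_pos[OF fin_simple_graph_complement[OF G], of v]
    unfolding NG_graph_def by auto
  then show ?thesis by (auto simp: A_part_def)
qed

lemma NG1_graph_complement: "NG1_graph G \<Longrightarrow> NG2_graph (graph_complement G)"
  by (simp add: NG1_graph_def NG2_graph_def NG_graph_complement A_part_graph_complement
      stable_set_graph_complement NG_graph_def[of G])

lemma NG2_graph_complement: "NG2_graph G \<Longrightarrow> NG1_graph (graph_complement G)"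
  by (simp add: NG1_graph_def NG2_graph_def NG_graph_complement A_part_graph_complement
      clique_graph_complement NG_graph_def[of G])

section \<open>The structure of NG-graphs whose \<open>A\<close>-part is a clique\<close>

text \<open>The last clause makes \<open>K\<close> a maximum clique: a clique contains at most one
  vertex of \<open>S\<close>, and if it contains one, it misses a vertex of
  \<open>K\<close>.\<close>

definition max_split :: "'a graph \<Rightarrow> 'a set \<Rightarrow> 'a set \<Rightarrow> bool" where
  "max_split G K S \<longleftrightarrow> K \<union> S = verts G \<and> K \<inter> S = {} \<and> clique G K \<and> stable_set G S \<and>
     (\<forall>s\<in>S. \<exists>k\<in>K. {s, k} \<notin> edges G)"

text \<open>The vertex \<open>a\<close> lies in the \<open>A\<close>-part, \<open>insert a K\<close> is \<open>A \<union> B\<close> and \<open>S\<close> is \<open>C\<close>.\<close>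

definition anchored_split :: "'a graph \<Rightarrow> 'a \<Rightarrow> 'a set \<Rightarrow> 'a set \<Rightarrow> bool" where
  "anchored_split G a K S \<longleftrightarrow> insert a (K \<union> S) = verts G \<and> a \<notin> K \<union> S \<and> K \<inter> S = {} \<and>
     clique G (insert a K) \<and> stable_set G (insert a S) \<and> (\<forall>s\<in>S. \<exists>k\<in>K. {s, k} \<notin> edges G)"

text \<open>\<open>insert a K\<close> is a clique in \<open>G\<close> and \<open>insert a S\<close>
  one in the complement, which bounds both chromatic numbers from below. Colouring these cliques
  injectively and the remaining vertices greedily shows that both bounds are attained, and they sum
  to the number of vertices plus one.\<close>

lemma anchored_split_NG1_graph:
  assumes G: "fin_simple_graph G" and a: "anchored_split G a K S"
  shows "NG1_graph G"
proof -
  have V: "insert a (K \<union> S) = verts G" and disj: "a \<notin> K" "a \<notin> S" "K \<inter> S = {}"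
    and cl: "clique G (insert a K)" and st: "stable_set G (insert a S)"
    and S: "\<And>s. s \<in> S \<Longrightarrow> \<exists>k\<in>K. {s, k} \<notin> edges G"
    using a by (simp_all add: anchored_split_def)
  have fin: "finite K" "finite S"
    using G V[symmetric] by (simp_all add: fin_simple_graph_def)
  have deg_S: "degree G s < card K" if "s \<in> S" for s
  proof -
    obtain k where k: "k \<in> K" "{s, k} \<notin> edges G" using S[OF \<open>s \<in> S\<close>] by blast
    have "u \<in> K - {k}" if "{u, s} \<in> edges G" for u
    proof -
      have "u \<in> verts G" using fin_simple_graphD(1)[OF G that] .
      moreover have "u \<noteq> k" using that k(2) by (auto simp: insert_commute)
      moreover have "u \<notin> insert a S"
        using st \<open>s \<in> S\<close> that by (auto simp: stable_set_def)
      ultimately show ?thesis using V by blast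
    qed
    then have "{u. {u, s} \<in> edges G} \<subset> K" using k by auto
    then show ?thesis by (simp add: degree_conv_card_neighbours[OF G] psubset_card_mono fin)
  qed
  have deg_K: "degree (graph_complement G) k \<le> card S" if "k \<in> K" for k
  proof -
    have "{u. {u, k} \<in> edges (graph_complement G)} \<subseteq> S"
      using V cl that by (auto simp: clique_def edge_graph_complement)
    then show ?thesis
      by (simp add: degree_conv_card_neighbours fin_simple_graph_complement[OF G] card_mono fin)
  qed
  have "chromatic_number G \<le> card K + 1"
    using V disj fin fin_simple_graphD(3)[OF G]
    by (intro chromatic_number_le_extension[OF G, of "insert a K" id])
      (auto intro: less_SucI deg_S)
  moreover have "card K + 1 \<le> chromatic_number G"
    using card_clique_le_chromatic_number[OF G, of "insert a K"] cl disj fin by simp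
  ultimately have chi: "chromatic_number G = card K + 1" by simp
  have "chromatic_number (graph_complement G) \<le> card S + 1"
    using V disj fin
    by (intro chromatic_number_le_extension[OF fin_simple_graph_complement[OF G], of "insert a S" id])
      (auto simp: edge_graph_complement less_Suc_eq_le intro: deg_K)
  moreover have "card S + 1 \<le> chromatic_number (graph_complement G)"
    using card_clique_le_chromatic_number[OF fin_simple_graph_complement[OF G], of "insert a S"]
      st disj fin by (simp add: clique_graph_complement[OF G])
  ultimately have "chromatic_number (graph_complement G) = card S + 1" by simp
  moreover have "card (insert a (K \<union> S)) = card K + card S + 1"
    using disj fin by (simp add: card_Un_disjoint)
  ultimately have "NG_graph G"
    using G chi V by (simp add: NG_graph_def)
  \<comment> \<open>A vertex of \<open>S\<close> has degree below \<open>card K\<close>, which is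
    the chromatic number minus one.\<close>
  moreover have "A_part G \<subseteq> insert a K"
    using V deg_S chi by (fastforce simp: A_part_def)
  then have "clique G (A_part G)" using cl unfolding clique_def by blast
  ultimately show ?thesis by (simp add: NG1_graph_def)
qed

text \<open>Everything follows from two lower bounds, \<open>colour\<close> and
  \<open>colour'\<close>, on the colours needed by \<open>L\<close> in \<open>G\<close> and by
  \<open>A \<union> C\<close> in the complement. Each structural claim is tested by a colouring that
  would be too cheap if the claim failed.\<close>

lemma NG1_graph_anchored_split:
  assumes "NG1_graph G"
  shows "\<exists>a K S. anchored_split G a K S"
proof -
  define \<chi> where "\<chi> = chromatic_number G"
  define \<chi>' where "\<chi>' = chromatic_number (graph_complement G)"
  define A where "A = A_part G"
  \<comment> \<open>This is \<open>A \<union> B\<close> of the ABC-partition.\<close>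
  define L where "L = {v \<in> verts G. \<chi> - 1 \<le> degree G v}"
  define C where "C = {v \<in> verts G. degree G v < \<chi> - 1}"
  have G: "fin_simple_graph G" and NG: "\<chi> + \<chi>' = card (verts G) + 1" and A: "clique G A"
    and ne: "verts G \<noteq> {}"
    using assms NG_graph_nonempty
    by (auto simp: NG1_graph_def NG_graph_def \<chi>_def \<chi>'_def A_def)
  note G' = fin_simple_graph_complement[OF G]
  have pos: "0 < \<chi>" "0 < \<chi>'"
    using ne chromatic_number_pos[OF G] chromatic_number_pos[OF G'] by (auto simp: \<chi>_def \<chi>'_def)
  have fin: "finite (verts G)" using G by (simp add: fin_simple_graph_def)
  have part: "L \<union> C = verts G" "L \<inter> C = {}" "A \<subseteq> L"
    by (auto simp: L_def C_def A_def A_part_def \<chi>_def)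
  have finp: "finite L" "finite C" "finite A"
    using fin part by (metis finite_Un finite_subset)+
  have cardLC: "card L + card C = card (verts G)"
    using part finp card_Un_disjoint by metis
  \<comment> \<open>Vertices outside \<open>L\<close> have degree below \<open>\<chi> - 1\<close>,
    so a colouring of \<open>L\<close> with at most \<open>\<chi> - 1\<close> colours would extend
    to all of \<open>G\<close>.\<close>
  have colour: "\<chi> \<le> card (c ` L)"
    if "\<And>u v. \<lbrakk>u \<in> L; v \<in> L; {u, v} \<in> edges G\<rbrakk> \<Longrightarrow> c u \<noteq> c v" for c :: "'a \<Rightarrow> 'a"
  proof (rule ccontr)
    assume "\<not> \<chi> \<le> card (c ` L)"
    then have "\<chi> \<le> \<chi> - 1"
      unfolding \<chi>_def using part that
      by (intro chromatic_number_le_extension[OF G, of L c]) (auto simp: L_def \<chi>_def)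
    then show False using pos by simp
  qed
  \<comment> \<open>The vertices of \<open>B\<close> are the low-degree ones in the complement, so
    there the greedy extension starts from \<open>A \<union> C\<close>.\<close>
  have deg': "degree (graph_complement G) v < \<chi>' - 1" if "v \<in> verts G" "v \<notin> A" "v \<notin> C" for v
    using that degree_graph_complement[OF G, of v] NG pos
    by (auto simp: C_def A_def A_part_def \<chi>_def)
  have colour': "\<chi>' \<le> card (c ` (A \<union> C))"
    if "\<And>u v. \<lbrakk>u \<in> A \<union> C; v \<in> A \<union> C; {u, v} \<in> edges (graph_complement G)\<rbrakk> \<Longrightarrow> c u \<noteq> c v"
    for c :: "'a \<Rightarrow> 'a"
  proof (rule ccontr)
    assume "\<not> \<chi>' \<le> card (c ` (A \<union> C))"
    then have "\<chi>' \<le> \<chi>' - 1"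
      unfolding \<chi>'_def using part that deg'[unfolded \<chi>'_def]
      by (intro chromatic_number_le_extension[OF G', of "A \<union> C" c]) (auto simp: \<chi>'_def L_def)
    then show False using pos by simp
  qed
  have "\<chi> \<le> card L" using colour[of id] fin_simple_graphD(3)[OF G] by auto
  \<comment> \<open>Otherwise \<open>C\<close> alone needs \<open>\<chi>'\<close> colours, and
    \<open>L\<close> and \<open>C\<close> together have too many vertices.\<close>
  have "A \<noteq> {}"
  proof
    assume "A = {}"
    then have "\<chi>' \<le> card C" using colour'[of id] fin_simple_graphD(3)[OF G'] by auto
    then show False using \<open>\<chi> \<le> card L\<close> NG cardLC by simp
  qed
  then obtain a where a: "a \<in> A" by auto
  then have a': "a \<in> L" "a \<notin> C" using part by auto
  \<comment> \<open>The clique \<open>A\<close> is stable in the complement, so all of it may share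
    the colour \<open>a\<close>; this leaves \<open>card C + 1\<close> colours.\<close>
  let ?c = "\<lambda>v. if v \<in> A then a else v"
  have img: "?c ` (A \<union> C) = insert a C" using a part by auto
  have "\<chi>' \<le> card (?c ` (A \<union> C))"
    using A a a' part
    by (intro colour') (auto simp: edge_graph_complement clique_def)
  then have "\<chi>' \<le> card C + 1" using img a' finp by simp
  then have cards: "card L = \<chi>" "card C + 1 = \<chi>'"
    using \<open>\<chi> \<le> card L\<close> NG cardLC by auto
  have L: "clique G L"
  proof (rule ccontr)
    assume "\<not> clique G L"
    then obtain x y where xy: "x \<in> L" "y \<in> L" "x \<noteq> y" "{x, y} \<notin> edges G"
      using part by (auto simp: clique_def)
    \<comment> \<open>Two non-adjacent vertices of \<open>L\<close> could share a colour, so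
      \<open>\<chi> - 1\<close> colours would do on \<open>L\<close>.\<close>
    then have "(id(y := x)) ` L = L - {y}" by auto
    moreover have "\<chi> \<le> card ((id(y := x)) ` L)"
      using xy no_loop[OF G] by (intro colour) (auto simp: insert_commute)
    ultimately show False using cards xy(2) finp pos by simp
  qed
  have C: "stable_set G C"
  proof (rule ccontr)
    assume "\<not> stable_set G C"
    then obtain x y where xy: "x \<in> C" "y \<in> C" "{x, y} \<in> edges G"
      using part by (auto simp: stable_set_def)
    then have "x \<noteq> y" using fin_simple_graphD(3)[OF G] by auto
    \<comment> \<open>An edge in \<open>C\<close> is a non-edge of the complement, so
      \<open>y\<close> can reuse the colour of \<open>x\<close>, which saves one of the
      \<open>card C + 1\<close> colours.\<close>
    let ?d = "(?c(y := x))"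
    have notA: "x \<notin> A" "y \<notin> A" using xy part by auto
    have "?d ` (A \<union> C) = insert a (C - {y})" using a a' xy notA \<open>x \<noteq> y\<close> part by auto
    moreover have "\<chi>' \<le> card (?d ` (A \<union> C))"
    proof (rule colour')
      fix u v assume "u \<in> A \<union> C" "v \<in> A \<union> C" "{u, v} \<in> edges (graph_complement G)"
      then show "?d u \<noteq> ?d v"
        using A a a' part xy notA
        by (auto simp: edge_graph_complement clique_def insert_commute split: if_splits)
    qed
    moreover have "card (insert a (C - {y})) = card C"
      using xy(2) finp a' card_Suc_Diff1[of C y] by simp
    ultimately show False using cards(2) by simp
  qed
  \<comment> \<open>The clique \<open>L\<close> already supplies \<open>\<chi> - 1\<close>
    neighbours of \<open>a\<close>, which is its full degree, so none are left in
    \<open>C\<close>.\<close>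
  have "{u. {u, a} \<in> edges G} = L - {a}"
  proof (rule sym, rule card_subset_eq[OF finite_neighbours[OF G]])
    show "L - {a} \<subseteq> {u. {u, a} \<in> edges G}" using L a' by (auto simp: clique_def)
    show "card (L - {a}) = card {u. {u, a} \<in> edges G}"
      using a a' cards finp degree_conv_card_neighbours[OF G, of a]
      by (simp add: A_def A_part_def \<chi>_def)
  qed
  then have aC: "{s, a} \<notin> edges G" if "s \<in> C" for s using that part by auto
  \<comment> \<open>A vertex \<open>s\<close> adjacent to all of \<open>L - {a}\<close> would have
    degree at least \<open>\<chi> - 1\<close>, too large for \<open>C\<close>.\<close>
  have "\<exists>k\<in>L - {a}. {s, k} \<notin> edges G" if "s \<in> C" for s
  proof (rule ccontr)
    assume "\<not> ?thesis"
    then have "L - {a} \<subseteq> {u. {u, s} \<in> edges G}" by (auto simp: insert_commute)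
    then have "card (L - {a}) \<le> degree G s"
      unfolding degree_conv_card_neighbours[OF G] by (rule card_mono[OF finite_neighbours[OF G]])
    then show False using that cards a' finp by (simp add: C_def)
  qed
  then have "anchored_split G a (L - {a}) C"
    using L C aC a' part no_loop[OF G]
    by (auto simp: anchored_split_def stable_set_def insert_absorb insert_commute)
  then show ?thesis by blast
qed

section \<open>Adding and removing a vertex\<close>

definition add_vertex :: "'a graph \<Rightarrow> 'a set \<Rightarrow> 'a \<Rightarrow> 'a graph" where
  "add_vertex H K a = \<lparr>verts = insert a (verts H), edges = edges H \<union> (\<lambda>k. {a, k}) ` K\<rparr>"

definition remove_vertex :: "'a graph \<Rightarrow> 'a \<Rightarrow> 'a graph" where
  "remove_vertex G a = \<lparr>verts = verts G - {a}, edges = {e \<in> edges G. a \<notin> e}\<rparr>"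

lemma verts_remove_vertex [simp]: "verts (remove_vertex G a) = verts G - {a}"
  by (simp add: remove_vertex_def)

lemma edge_remove_vertex:
  "{u, v} \<in> edges (remove_vertex G a) \<longleftrightarrow> {u, v} \<in> edges G \<and> u \<noteq> a \<and> v \<noteq> a"
  by (auto simp: remove_vertex_def)

lemma fin_simple_graph_remove_vertex:
  "fin_simple_graph G \<Longrightarrow> fin_simple_graph (remove_vertex G a)"
  by (auto simp: fin_simple_graph_def remove_vertex_def)

lemma fin_simple_graph_add_vertex:
  assumes "fin_simple_graph H" "a \<notin> verts H" "K \<subseteq> verts H"
  shows "fin_simple_graph (add_vertex H K a)"
  using assms by (fastforce simp: fin_simple_graph_def add_vertex_def card_insert_if)

lemma remove_add_vertex:
  assumes "fin_simple_graph H" "a \<notin> verts H"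
  shows "remove_vertex (add_vertex H K a) a = H"
  using assms by (cases H) (auto simp: fin_simple_graph_def remove_vertex_def add_vertex_def)

lemma edge_add_vertex:
  "{u, v} \<in> edges (add_vertex H K a) \<longleftrightarrow>
     {u, v} \<in> edges H \<or> (u = a \<and> v \<in> K) \<or> (v = a \<and> u \<in> K)"
  by (auto simp: add_vertex_def doubleton_eq_iff)

text \<open>Freshness of \<open>a\<close> means that its only edges are the new ones, so it sees
  exactly \<open>K\<close>, and non-edges between \<open>S\<close> and \<open>K\<close>
  survive.\<close>

lemma max_split_anchored_add_vertex:
  assumes "fin_simple_graph H" "max_split H K S" "a \<notin> verts H"
  shows "anchored_split (add_vertex H K a) a K S"
proof -
  have [simp]: "verts (add_vertex H K a) = insert a (verts H)" by (simp add: add_vertex_def)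
  have "{u, a} \<notin> edges H" "{a, u} \<notin> edges H" for u
    using assms fin_simple_graphD[OF assms(1)] by blast+
  then have "clique (add_vertex H K a) (insert a K)" "stable_set (add_vertex H K a) (insert a S)"
    using assms no_loop[OF assms(1), of a]
    by (auto simp: max_split_def clique_def stable_set_def edge_add_vertex)
  moreover have "\<forall>s\<in>S. \<exists>k\<in>K. {s, k} \<notin> edges (add_vertex H K a)"
    using assms unfolding max_split_def edge_add_vertex by blast
  ultimately show ?thesis
    using assms by (simp add: max_split_def anchored_split_def)
qed

lemma anchored_split_remove_vertex:
  assumes "anchored_split G a K S"
  shows "max_split (remove_vertex G a) K S"
  using assms
  by (auto simp: max_split_def anchored_split_def clique_def stable_set_def edge_remove_vertex)

lemma max_split_split_graph:
  "fin_simple_graph G \<Longrightarrow> max_split G K S \<Longrightarrow> split_graph G"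
  by (auto simp: max_split_def split_graph_def)

text \<open>If some \<open>s\<close> in \<open>S\<close> is adjacent to all of \<open>K\<close>,
  move it to the clique. One move suffices, because \<open>s\<close> itself is then a non-neighbour
  in the clique for every remaining vertex of \<open>S\<close>.\<close>

lemma split_graph_max_split:
  assumes "split_graph G"
  shows "\<exists>K S. max_split G K S"
proof -
  obtain K S where KS: "K \<union> S = verts G" "K \<inter> S = {}" "clique G K" "stable_set G S"
    using assms by (auto simp: split_graph_def)
  show ?thesis
  proof (cases "\<exists>s\<in>S. \<forall>k\<in>K. {s, k} \<in> edges G")
    case True
    then obtain s where "s \<in> S" "\<forall>k\<in>K. {s, k} \<in> edges G" by auto
    then have "max_split G (insert s K) (S - {s})"
      using KS by (auto simp: max_split_def clique_def stable_set_def insert_commute)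
    then show ?thesis by blast
  next
    case False
    then show ?thesis using KS by (auto simp: max_split_def)
  qed
qed

section \<open>Uniqueness of the partitions\<close>

text \<open>Swapping twins is an automorphism, whether or not the twins are adjacent. It provides
  the corrections needed in both uniqueness arguments.\<close>

lemma graph_isomorphism_transpose:
  assumes G: "fin_simple_graph G" and xy: "x \<in> verts G" "y \<in> verts G"
    and twins: "\<And>z. z \<noteq> x \<Longrightarrow> z \<noteq> y \<Longrightarrow> {z, x} \<in> edges G \<longleftrightarrow> {z, y} \<in> edges G"
  shows "graph_isomorphism (transpose x y) G G"
proof -
  have "transpose x y ` verts G = verts G"
    using xy by (auto simp: transpose_def image_iff)
  then have "bij_betw (transpose x y) (verts G) (verts G)"
    using inj_on_subset[OF inj_transpose] by (auto simp: bij_betw_def)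
  moreover have "{u, v} \<in> edges G \<longleftrightarrow> {transpose x y u, transpose x y v} \<in> edges G" for u v
  proof -
    have twins': "{x, z} \<in> edges G \<longleftrightarrow> {y, z} \<in> edges G" if "z \<noteq> x" "z \<noteq> y" for z
      using twins[OF that] by (simp add: insert_commute)
    consider "u \<notin> {x, y}" | "v \<notin> {x, y}" | "u = v" | "u = x" "v = y" | "u = y" "v = x"
      by auto
    then show ?thesis
    proof cases
      case 1
      then show ?thesis using twins[of u] by (auto simp: transpose_def)
    next
      case 2
      then show ?thesis using twins'[of v] by (auto simp: transpose_def)
    next
      case 3
      then show ?thesis using no_loop[OF G] by simp
    qed (simp_all add: insert_commute)
  qed
  ultimately show ?thesis by (simp add: graph_isomorphism_def)
qed

text \<open>Two different maximum cliques of this kind differ by exchanging one vertex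
  \<open>x\<close> for one vertex \<open>y\<close>, and these are twins, so their transposition is
  the automorphism.\<close>

lemma max_split_unique:
  assumes G: "fin_simple_graph G" and KS: "max_split G K S" and KS': "max_split G K' S'"
  shows "\<exists>f. graph_isomorphism f G G \<and> f ` K = K'"
proof (cases "K = K'")
  case True
  then show ?thesis using graph_isomorphism_id by force
next
  case False
  note 1 = KS[unfolded max_split_def] and 2 = KS'[unfolded max_split_def]
  \<comment> \<open>A vertex of \<open>K'\<close> outside \<open>K\<close> lies in \<open>S\<close>
    and has a non-neighbour in \<open>K\<close>, which would also lie in the clique
    \<open>K'\<close>.\<close>
  have "\<not> K \<subseteq> K'"
  proof
    assume "K \<subseteq> K'"
    then obtain s where s: "s \<in> K'" "s \<in> S" using False 1 2 by blast
    then obtain k where k: "k \<in> K" "{s, k} \<notin> edges G" using 1 2 by blast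
    then have "s \<noteq> k" "k \<in> K'" using 1 s \<open>K \<subseteq> K'\<close> by blast+
    moreover have "clique G K'" using 2 by blast
    ultimately show False using s k unfolding clique_def by blast
  qed
  moreover have "\<not> K' \<subseteq> K"
  proof
    assume "K' \<subseteq> K"
    then obtain s where s: "s \<in> K" "s \<in> S'" using False 1 2 by blast
    then obtain k where k: "k \<in> K'" "{s, k} \<notin> edges G" using 1 2 by blast
    then have "s \<noteq> k" "k \<in> K" using 2 s \<open>K' \<subseteq> K\<close> by blast+
    moreover have "clique G K" using 1 by blast
    ultimately show False using s k unfolding clique_def by blast
  qed
  ultimately obtain x y where "x \<in> K" "x \<notin> K'" "y \<in> K'" "y \<notin> K" by blast
  moreover have cover: "K \<union> S = verts G" "K' \<union> S' = verts G"
    and cl: "clique G K" "clique G K'" and st: "stable_set G S" "stable_set G S'"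
    using 1 2 by blast+
  ultimately have x: "x \<in> K" "x \<in> S'" "x \<notin> K'" and y: "y \<in> K'" "y \<in> S" "y \<notin> K"
    by blast+
  \<comment> \<open>A clique and a stable set share at most one vertex.\<close>
  have "K \<inter> S' \<subseteq> {x}" using cl(1) st(2) x unfolding clique_def stable_set_def by blast
  moreover have "K' \<inter> S \<subseteq> {y}" using cl(2) st(1) y unfolding clique_def stable_set_def by blast
  ultimately have K': "K' = insert y (K - {x})" using cover x y by blast
  \<comment> \<open>Such a \<open>z\<close> lies in both cliques and sees both vertices, or in both
    stable sets (or outside the graph) and sees neither.\<close>
  have "{z, x} \<in> edges G \<longleftrightarrow> {z, y} \<in> edges G" if "z \<noteq> x" "z \<noteq> y" for z
  proof (cases "z \<in> K")
    case True
    then have "z \<in> K'" using K' that by blast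
    then show ?thesis using True cl x y that by (simp add: clique_def)
  next
    case False
    then have "z \<in> S \<and> z \<in> S' \<or> z \<notin> verts G" using cover K' that by auto
    then show ?thesis using st x y fin_simple_graphD(1)[OF G] by (auto simp: stable_set_def)
  qed
  then have "graph_isomorphism (transpose x y) G G"
    using cover x y by (intro graph_isomorphism_transpose[OF G]) auto
  moreover have "transpose x y ` K = K'"
    using x y K' by (auto simp: transpose_def image_iff)
  ultimately show ?thesis by blast
qed

text \<open>Used in both directions, this shows that \<open>insert a K\<close> depends on
  \<open>G\<close> alone. A vertex \<open>x\<close> of it lying in \<open>T\<close> would miss both
  \<open>b\<close> and some \<open>y\<close> in \<open>L\<close>. These two would then lie in the
  stable set \<open>S\<close>, although they are adjacent.\<close>

lemma anchored_split_subset: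
  assumes "anchored_split G a K S" "anchored_split G b L T"
  shows "insert a K \<subseteq> insert b L"
proof
  have V: "insert a (K \<union> S) = verts G" "insert b (L \<union> T) = verts G"
    and cl: "clique G (insert a K)" "clique G (insert b L)"
    and st: "stable_set G (insert a S)" "stable_set G (insert b T)"
    and T: "\<And>t. t \<in> T \<Longrightarrow> \<exists>k\<in>L. {t, k} \<notin> edges G" and bL: "b \<notin> L"
    using assms by (simp_all add: anchored_split_def)
  fix x assume x: "x \<in> insert a K"
  show "x \<in> insert b L"
  proof (rule ccontr)
    assume "x \<notin> insert b L"
    moreover have "x \<in> verts G" using cl(1) x by (auto simp: clique_def)
    ultimately have xT: "x \<in> T" using V by blast
    then obtain y where y: "y \<in> L" "{x, y} \<notin> edges G" using T by blast
    have b: "{x, b} \<notin> edges G" using st(2) xT by (simp add: stable_set_def)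
    have "x \<noteq> y" "x \<noteq> b" using y \<open>x \<notin> insert b L\<close> by auto
    then have "y \<notin> insert a K" "b \<notin> insert a K"
      using cl(1) x y(2) b unfolding clique_def by blast+
    then have "y \<in> S" "b \<in> S" using V y(1) by blast+
    then have "{y, b} \<notin> edges G" using st(1) by (simp add: stable_set_def)
    moreover have "y \<noteq> b" using y(1) bL by blast
    ultimately show False using cl(2) y(1) by (simp add: clique_def)
  qed
qed

lemma edge_anchor:
  assumes "fin_simple_graph G" "anchored_split G a K S"
  shows "{a, v} \<in> edges G \<longleftrightarrow> v \<in> K" "{v, a} \<in> edges G \<longleftrightarrow> v \<in> K"
proof -
  show "{a, v} \<in> edges G \<longleftrightarrow> v \<in> K"
    using assms fin_simple_graphD[OF assms(1), of a v]
    by (auto simp: anchored_split_def clique_def stable_set_def)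
  then show "{v, a} \<in> edges G \<longleftrightarrow> v \<in> K" by (simp add: insert_commute)
qed

section \<open>Transport of the partitions along isomorphisms\<close>

lemma graph_isomorphism_clique:
  assumes "graph_isomorphism f G H" "clique G K"
  shows "clique H (f ` K)"
proof -
  have "K \<subseteq> verts G" using assms by (simp add: clique_def)
  then show ?thesis
    using assms by (auto simp: graph_isomorphism_def clique_def subset_iff dest: bij_betwE)
qed

lemma graph_isomorphism_stable_set:
  assumes "graph_isomorphism f G H" "stable_set G S"
  shows "stable_set H (f ` S)"
proof -
  have "S \<subseteq> verts G" using assms by (simp add: stable_set_def)
  then show ?thesis
    using assms by (auto simp: graph_isomorphism_def stable_set_def subset_iff dest: bij_betwE)
qed

lemma graph_isomorphism_non_neighbours:
  assumes "graph_isomorphism f G H" "K \<subseteq> verts G" "S \<subseteq> verts G"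
    and "\<forall>s\<in>S. \<exists>k\<in>K. {s, k} \<notin> edges G"
  shows "\<forall>s\<in>f ` S. \<exists>k\<in>f ` K. {s, k} \<notin> edges H"
proof
  fix t assume "t \<in> f ` S"
  then obtain s where s: "s \<in> S" "t = f s" by auto
  then obtain k where k: "k \<in> K" "{s, k} \<notin> edges G" using assms(4) by blast
  then have "{f s, f k} \<notin> edges H"
    using assms(1-3) s by (auto simp: graph_isomorphism_def subset_iff)
  then show "\<exists>k\<in>f ` K. {t, k} \<notin> edges H" using s k by blast
qed

lemma graph_isomorphism_max_split:
  assumes f: "graph_isomorphism f G H" and KS: "max_split G K S"
  shows "max_split H (f ` K) (f ` S)"
proof -
  note KS' = KS[unfolded max_split_def]
  have b: "f ` verts G = verts H" "inj_on f (verts G)"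
    using f by (auto simp: graph_isomorphism_def bij_betw_def)
  have sub: "K \<subseteq> verts G" "S \<subseteq> verts G" using KS' by auto
  have "f ` K \<union> f ` S = verts H" using KS' b(1) by (simp flip: image_Un)
  moreover have "f ` K \<inter> f ` S = {}"
    using KS' inj_on_image_Int[OF b(2) sub] by simp
  moreover have "clique H (f ` K)" "stable_set H (f ` S)"
    using KS' graph_isomorphism_clique[OF f] graph_isomorphism_stable_set[OF f] by blast+
  moreover have "\<forall>s\<in>f ` S. \<exists>k\<in>f ` K. {s, k} \<notin> edges H"
    using KS' by (intro graph_isomorphism_non_neighbours[OF f sub]) blast
  ultimately show ?thesis by (simp add: max_split_def)
qed

lemma graph_isomorphism_anchored_split:
  assumes f: "graph_isomorphism f G H" and aKS: "anchored_split G a K S"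
  shows "anchored_split H (f a) (f ` K) (f ` S)"
proof -
  note aKS' = aKS[unfolded anchored_split_def]
  have b: "f ` verts G = verts H" "inj_on f (verts G)"
    using f by (auto simp: graph_isomorphism_def bij_betw_def)
  have sub: "K \<subseteq> verts G" "S \<subseteq> verts G" "a \<in> verts G" using aKS' by auto
  have "insert (f a) (f ` K \<union> f ` S) = verts H"
    using aKS' b(1) by (simp flip: image_Un image_insert)
  moreover have "f ` K \<inter> f ` S = {}"
    using aKS' inj_on_image_Int[OF b(2) sub(1,2)] by simp
  moreover have "f a \<notin> f ` K \<union> f ` S"
    using aKS' sub inj_on_image_mem_iff[OF b(2)] by auto
  moreover have "clique H (insert (f a) (f ` K))" "stable_set H (insert (f a) (f ` S))"
    using aKS' graph_isomorphism_clique[OF f, of "insert a K"]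
      graph_isomorphism_stable_set[OF f, of "insert a S"] by simp_all
  moreover have "\<forall>s\<in>f ` S. \<exists>k\<in>f ` K. {s, k} \<notin> edges H"
    using aKS' by (intro graph_isomorphism_non_neighbours[OF f sub(1,2)]) blast
  ultimately show ?thesis
    by (simp add: anchored_split_def)
qed

lemma graph_isomorphism_remove_vertex:
  assumes "graph_isomorphism f G H" "a \<in> verts G"
  shows "graph_isomorphism f (remove_vertex G a) (remove_vertex H (f a))"
proof -
  have f: "bij_betw f (verts G) (verts H)" using assms by (simp add: graph_isomorphism_def)
  then have "bij_betw f (verts G - {a}) (verts H - {f a})"
    using assms(2) bij_betwE[OF f] by (intro bij_betw_DiffI) (auto simp: bij_betw_def)
  then show ?thesis
    using assms inj_onD[OF bij_betw_imp_inj_on[OF f]]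
    by (auto simp: graph_isomorphism_def edge_remove_vertex)
qed

text \<open>Deletion is well defined and injective on isomorphism classes, whichever anchors are
  chosen. Forwards, an isomorphism is corrected so that it maps \<open>a\<close> to
  \<open>b\<close>; backwards, one of the smaller graphs is corrected so that it maps
  \<open>K\<close> to \<open>L\<close>, and then extended by \<open>a\<close> to
  \<open>b\<close>.\<close>

lemma graph_iso_remove_anchor:
  assumes G: "fin_simple_graph G" "anchored_split G a K S"
    and H: "fin_simple_graph H" "anchored_split H b L T"
  shows "graph_iso G H \<longleftrightarrow> graph_iso (remove_vertex G a) (remove_vertex H b)"
proof
  assume "graph_iso G H"
  then obtain f where f: "graph_isomorphism f G H" by (auto simp: graph_iso_conv)
  note fa = graph_isomorphism_anchored_split[OF f G(2)]
  have eq: "insert (f a) (f ` K) = insert b L"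
    using anchored_split_subset[OF fa H(2)] anchored_split_subset[OF H(2) fa] by blast
  \<comment> \<open>Both anchors see everything else in the common set \<open>insert b L\<close> and
    nothing outside it, so they are twins.\<close>
  have "{z, f a} \<in> edges H \<longleftrightarrow> {z, b} \<in> edges H" if "z \<noteq> f a" "z \<noteq> b" for z
  proof -
    have "z \<in> f ` K \<longleftrightarrow> z \<in> L" using eq that by blast
    then show ?thesis
      using edge_anchor[OF H(1) fa] edge_anchor[OF H] by simp
  qed
  then have "graph_isomorphism (transpose (f a) b) H H"
    using fa H by (intro graph_isomorphism_transpose) (auto simp: anchored_split_def)
  then have "graph_isomorphism (transpose (f a) b \<circ> f) G H"
    using f graph_isomorphism_comp by blast
  then have "graph_isomorphism (transpose (f a) b \<circ> f) (remove_vertex G a) (remove_vertex H b)"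
    using graph_isomorphism_remove_vertex[of _ G H a] G by (fastforce simp: anchored_split_def)
  then show "graph_iso (remove_vertex G a) (remove_vertex H b)"
    by (auto simp: graph_iso_conv)
next
  assume "graph_iso (remove_vertex G a) (remove_vertex H b)"
  then obtain g where g: "graph_isomorphism g (remove_vertex G a) (remove_vertex H b)"
    by (auto simp: graph_iso_conv)
  \<comment> \<open>The image of \<open>K\<close> under \<open>g\<close> and the set
    \<open>L\<close> are both cliques of maximum split partitions of the same graph, so an
    automorphism matches them.\<close>
  obtain h where h: "graph_isomorphism h (remove_vertex H b) (remove_vertex H b)" "h ` g ` K = L"
    using max_split_unique[OF fin_simple_graph_remove_vertex[OF H(1)]
        graph_isomorphism_max_split[OF g anchored_split_remove_vertex[OF G(2)]]
        anchored_split_remove_vertex[OF H(2)]] by blast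
  define f where "f = h \<circ> g"
  have f: "graph_isomorphism f (remove_vertex G a) (remove_vertex H b)" and fK: "f ` K = L"
    using g h graph_isomorphism_comp by (auto simp: f_def)
  have ab: "a \<in> verts G" "b \<in> verts H" "K \<subseteq> verts G - {a}" "b \<notin> L"
    using G(2) H(2) by (auto simp: anchored_split_def)
  have bij: "bij_betw f (verts G - {a}) (verts H - {b})"
    using f by (simp add: graph_isomorphism_def)
  have f_in: "f u \<in> verts H" "f u \<noteq> b" if "u \<in> verts G" "u \<noteq> a" for u
    using bij_betwE[OF bij] that by auto
  have mem: "f u \<in> L \<longleftrightarrow> u \<in> K" if "u \<in> verts G" "u \<noteq> a" for u
    using inj_on_image_mem_iff[OF bij_betw_imp_inj_on[OF bij], of u K] that ab fK by auto
  have "bij_betw (f(a := b)) (verts G - {a}) (verts H - {b})"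
    using bij by (rule bij_betw_cong[THEN iffD1, rotated]) auto
  then have "bij_betw (f(a := b)) (verts G - {a} \<union> {a}) (verts H - {b} \<union> {b})"
    by (intro bij_betw_combine) (auto simp: bij_betw_def)
  then have "bij_betw (f(a := b)) (verts G) (verts H)"
    using ab by (simp add: insert_absorb)
  moreover have "{u, v} \<in> edges G \<longleftrightarrow> {(f(a := b)) u, (f(a := b)) v} \<in> edges H"
    if uv: "u \<in> verts G" "v \<in> verts G" for u v
  proof -
    have "{u, v} \<in> edges G \<longleftrightarrow> {f u, f v} \<in> edges H" if "u \<noteq> a" "v \<noteq> a"
      using f uv that f_in by (auto simp: graph_isomorphism_def edge_remove_vertex)
    \<comment> \<open>Edges at the anchors are decided by membership in \<open>K\<close> and in
      \<open>L\<close>, which \<open>f\<close> matches.\<close>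
    then show ?thesis
      using uv ab edge_anchor[OF G] edge_anchor[OF H] mem no_loop[OF G(1)] no_loop[OF H(1)]
      by auto
  qed
  ultimately show "graph_iso G H"
    unfolding graph_iso_def by blast
qed

section \<open>The bijections\<close>

lemma bij_betw_unlabeled:
  assumes "\<And>G. \<lbrakk>fin_simple_graph G; P G; card (verts G) = m\<rbrakk>
      \<Longrightarrow> \<exists>H. fin_simple_graph H \<and> Q H \<and> card (verts H) = n \<and> R G H"
    and "\<And>H. \<lbrakk>fin_simple_graph H; Q H; card (verts H) = n\<rbrakk>
      \<Longrightarrow> \<exists>G. fin_simple_graph G \<and> P G \<and> card (verts G) = m \<and> R G H"
    and "\<And>G G' H H'. \<lbrakk>fin_simple_graph G; fin_simple_graph G'; fin_simple_graph H;
      fin_simple_graph H'; R G H; R G' H'\<rbrakk> \<Longrightarrow> (G, G') \<in> iso_rel \<longleftrightarrow> (H, H') \<in> iso_rel"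
  shows "\<exists>f. bij_betw f (unlabeled P m) (unlabeled Q n)"
  unfolding unlabeled_def
proof (rule bij_betw_quotients[OF equiv_iso_rel _ equiv_iso_rel, where R = R], goal_cases)
  case (3 G)
  then show ?case using assms(1)[of G] by blast
next
  case (4 H)
  then show ?case using assms(2)[of H] by blast
next
  case (5 G G' H H')
  then show ?case using assms(3)[of G G' H H'] by simp
qed auto

lemma bij_betw_NG1_NG2: "\<exists>f. bij_betw f (unlabeled NG1_graph n) (unlabeled NG2_graph n)"
proof (rule bij_betw_unlabeled[where R = "\<lambda>G H. H = graph_complement G"])
  fix H :: "nat graph" assume "fin_simple_graph H" "NG2_graph H" "card (verts H) = n"
  then show "\<exists>G. fin_simple_graph G \<and> NG1_graph G \<and> card (verts G) = n \<and> H = graph_complement G"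
    by (intro exI[of _ "graph_complement H"])
      (simp add: fin_simple_graph_complement NG2_graph_complement graph_complement_involutive)
next
  fix G G' H H' :: "nat graph"
  assume "fin_simple_graph G" "fin_simple_graph G'"
    and "H = graph_complement G" "H' = graph_complement G'"
  then show "(G, G') \<in> iso_rel \<longleftrightarrow> (H, H') \<in> iso_rel"
    using iso_rel_complement[of G G'] iso_rel_complement[of H H']
    by (auto simp: graph_complement_involutive)
qed (auto simp: fin_simple_graph_complement NG1_graph_complement)

text \<open>The relation leaves the anchor free: a graph may have several, and
  \<open>graph_iso_remove_anchor\<close> shows that the choice does not affect the isomorphism
  class.\<close>

lemma bij_betw_NG1_split:
  assumes "n \<ge> 1"
  shows "\<exists>f. bij_betw f (unlabeled NG1_graph n) (unlabeled split_graph (n - 1))"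
proof (rule bij_betw_unlabeled
    [where R = "\<lambda>G H. \<exists>a K S. anchored_split G a K S \<and> H = remove_vertex G a"])
  fix G :: "nat graph" assume G: "fin_simple_graph G" "NG1_graph G" "card (verts G) = n"
  obtain a K S where a: "anchored_split G a K S" using NG1_graph_anchored_split G by blast
  then have "a \<in> verts G" by (auto simp: anchored_split_def)
  then have "card (verts (remove_vertex G a)) = n - 1" using G by simp
  moreover note fin_simple_graph_remove_vertex[OF G(1), of a]
  moreover have "split_graph (remove_vertex G a)"
    using max_split_split_graph anchored_split_remove_vertex[OF a] calculation(2) by blast
  ultimately show "\<exists>H. fin_simple_graph H \<and> split_graph H \<and> card (verts H) = n - 1 \<and>
      (\<exists>a K S. anchored_split G a K S \<and> H = remove_vertex G a)"
    using a by (intro exI[of _ "remove_vertex G a"]) auto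
next
  fix H :: "nat graph"
  assume H: "fin_simple_graph H" "split_graph H" "card (verts H) = n - 1"
  then have fin: "finite (verts H)" by (simp add: fin_simple_graph_def)
  then obtain a where a: "a \<notin> verts H" using ex_new_if_finite[OF infinite_UNIV_nat] by blast
  obtain K S where KS: "max_split H K S" using split_graph_max_split H by blast
  let ?G = "add_vertex H K a"
  have G: "fin_simple_graph ?G"
    using H a KS by (intro fin_simple_graph_add_vertex) (auto simp: max_split_def)
  note anch = max_split_anchored_add_vertex[OF H(1) KS a]
  \<comment> \<open>Here \<open>n \<ge> 1\<close> matters: only then does adding one vertex to
    \<open>n - 1\<close> give \<open>n\<close>.\<close>
  have "card (verts ?G) = n" using a fin H assms by (simp add: add_vertex_def)
  then show "\<exists>G. fin_simple_graph G \<and> NG1_graph G \<and> card (verts G) = n \<and>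
      (\<exists>a K S. anchored_split G a K S \<and> H = remove_vertex G a)"
    using G anch anchored_split_NG1_graph[OF G anch] remove_add_vertex[OF H(1) a, of K] by metis
next
  fix G G' H H' :: "nat graph"
  assume "fin_simple_graph G" "fin_simple_graph G'" "fin_simple_graph H" "fin_simple_graph H'"
    "\<exists>a K S. anchored_split G a K S \<and> H = remove_vertex G a"
    "\<exists>a K S. anchored_split G' a K S \<and> H' = remove_vertex G' a"
  then show "(G, G') \<in> iso_rel \<longleftrightarrow> (H, H') \<in> iso_rel"
    using graph_iso_remove_anchor by (fastforce simp: iso_rel_def)
qed

text \<open>The third bijection is the inverse of the first followed by the second.\<close>

theorem theorem4p3:
  fixes n :: nat
  assumes "n \<ge> 1"
  shows "(\<exists>f. bij_betw f (unlabeled NG1_graph n) (unlabeled NG2_graph n)) \<and>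
         (\<exists>g. bij_betw g (unlabeled NG1_graph n) (unlabeled split_graph (n - 1))) \<and>
         (\<exists>h. bij_betw h (unlabeled NG2_graph n) (unlabeled split_graph (n - 1)))"
  using bij_betw_NG1_NG2[of n] bij_betw_NG1_split[OF assms]
  by (meson bij_betw_inv bij_betw_trans)

end
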